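(* Let $A=\{a_n\}_{n\in\mathbb{N}}\subset\mathbb{R}^d$ be a roughly shift-invariant multiset. Then there exists a number $D>0$ (the density of $A$) such that, uniformly with respect to $x\in\mathbb{R}^d$, $$\lim_{T\to\infty}\frac{\#(A\cap B(x,T))}{m_d(B(x,T))}=D.$$
   Context: A discrete multiset in $\mathbb{R}^d$ is a sequence $A=\{a_n\}_{n\in\mathbb{N}}\subset\mathbb{R}^d$ without finite limit points, i.e. every ball contains $a_n$ for only finitely many indices $n$ (points may be repeated, the number of repetitions being the multiplicity). A discrete multiset $A=\{a_n\}_{n\in\mathbb{N}}$ is called roughly shift-invariant if there exists $L<\infty$ such that for every $x\in\mathbb{R}^d$ there is a bijection $\sigma_x:\mathbb{N}\to\mathbb{N}$ with $\sup_{n\in\mathbb{N}}|a_n+x-a_{\sigma_x(n)}|<L$ (with $L$ independent of $x$). The symbol $\#E$ denotes the number of points of a finite multiset $E$, each point counted according to its multiplicity; thus $\#(A\cap B(x,T))=\#\{n\in\mathbb{N}: a_n\in B(x,T)\}$. $m_d$ is $d$-dimensional Lebesgue measure and $B(x,T)$ is the open ball of radius $T$ centered at $x$. *)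

theory Defs
  imports "HOL-Analysis.Analysis"
begin

(* Multisets are represented by sequences a :: nat => 'a; the multiplicity of a
   point p is the number of indices n with a n = p. *)

definition discrete_multiset :: "(nat \<Rightarrow> 'a::metric_space) \<Rightarrow> bool" where
  "discrete_multiset a \<longleftrightarrow> (\<forall>c r. finite {n. a n \<in> ball c r})"

(* The supremum is taken in the extended reals, because on type real the
   supremum of an unbounded set is an unspecified number. *)
definition roughly_shift_invariant :: "(nat \<Rightarrow> 'a::real_normed_vector) \<Rightarrow> bool" where
  "roughly_shift_invariant a \<longleftrightarrow>
     discrete_multiset a \<and>
     (\<exists>L::real. \<forall>x. \<exists>\<sigma>::nat \<Rightarrow> nat. bij \<sigma> \<and>
        (SUP n. ereal (norm (a n + x - a (\<sigma> n)))) < ereal L)"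

(* Number of points with multiplicity: indices are counted, not values. It is
   meaningful only if finitely many indices n satisfy a n \<in> E. *)
definition num_points :: "(nat \<Rightarrow> 'a) \<Rightarrow> 'a set \<Rightarrow> nat" where
  "num_points a E = card {n. a n \<in> E}"

end

theory Submission
  imports Defs
begin

text \<open>
  Write \<open>N(x,T)\<close> for the number of points in the ball of radius \<open>T\<close> around \<open>x\<close>, and \<open>V(T)\<close> for
  the volume of such a ball.  Rough shift-invariance with constant \<open>L\<close> moves the points of one ball
  injectively into any other ball whose radius is larger by \<open>L\<close>, so \<open>N(x,S) \<le> N(y,S+L)\<close> for all
  \<open>x\<close> and \<open>y\<close> (lemma \<open>num_points_ball_shift\<close>).  Counts at a fixed radius thus depend on the centre
  only up to a change of the radius by \<open>L\<close>.

  To compare different radii, count in two ways the pairs of a point \<open>a\<^sub>n\<close> in a large ball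
  \<open>B(z,R)\<close> and a location \<open>w\<close> within distance \<open>T\<close> of \<open>a\<^sub>n\<close>: integrating the number of such
  points over \<open>w\<close> gives \<open>N(z,R) V(T)\<close>.  If every ball of radius \<open>T\<close> contains at most (at least)
  \<open>c\<close> points, this integral is at most \<open>c V(R+T)\<close> (at least \<open>c V(R-T)\<close>).  By the first step, every
  ball of radius \<open>S+L\<close> contains at least \<open>N(x,S)\<close> points and every ball of radius \<open>T-L\<close> at most
  \<open>N(y,T)\<close>.  The two resulting bounds for the same \<open>N(z,R)\<close>, divided by \<open>V(R)\<close>, give for \<open>R \<rightarrow> \<infinity>\<close>
  \[ N(x,S) / V(S+L) \le N(y,T) / V(T-L) \]
  for all centres and all radii \<open>S > 0\<close>, \<open>T > L\<close> (lemma \<open>density_comparison\<close>).  Any number \<open>D\<close>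
  that separates the left-hand sides from the right-hand sides satisfies
  \<open>D V(T-L) \<le> N(x,T) \<le> D V(T+L)\<close>, and \<open>D > 0\<close> because some left-hand side is positive.  Since \<open>V(T \<plusminus> L) / V(T) \<rightarrow> 1\<close>, it is the density, and the
  convergence is uniform because the bounds do not involve \<open>x\<close>.
\<close>

section \<open>Counting points in shifted balls\<close>

lemma roughly_shift_invariantE:
  assumes "roughly_shift_invariant a"
  obtains L where "L > 0"
    and "\<And>x. \<exists>\<sigma>. bij \<sigma> \<and> (\<forall>n. norm (a n + x - a (\<sigma> n)) < L)"
proof -
  obtain L where L: "\<And>x. \<exists>\<sigma>. bij \<sigma> \<and> (SUP n. ereal (norm (a n + x - a (\<sigma> n)))) < ereal L"
    using assms unfolding roughly_shift_invariant_def by blast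
  have shift: "\<exists>\<sigma>. bij \<sigma> \<and> (\<forall>n. norm (a n + x - a (\<sigma> n)) < L)" for x
  proof -
    obtain \<sigma> where \<sigma>: "bij \<sigma>" "(SUP n. ereal (norm (a n + x - a (\<sigma> n)))) < ereal L"
      using L by blast
    have "ereal (norm (a n + x - a (\<sigma> n))) < ereal L" for n
      using \<sigma>(2) by (rule le_less_trans[OF SUP_upper[OF UNIV_I]])
    with \<sigma>(1) show ?thesis by auto
  qed
  moreover have "L > 0"
    using shift[of 0] norm_ge_zero le_less_trans by blast
  ultimately show ?thesis using that by blast
qed

lemma num_points_ball_shift:
  fixes a :: "nat \<Rightarrow> 'a::real_normed_vector"
  assumes discrete: "discrete_multiset a"
    and shift: "\<exists>\<sigma>. bij \<sigma> \<and> (\<forall>n. norm (a n + (y - x) - a (\<sigma> n)) < L)"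
  shows "num_points a (ball x S) \<le> num_points a (ball y (S + L))"
proof -
  obtain \<sigma> where \<sigma>: "bij \<sigma>" "\<And>n. norm (a n + (y - x) - a (\<sigma> n)) < L"
    using shift by blast
  have "a (\<sigma> n) \<in> ball y (S + L)" if "a n \<in> ball x S" for n
  proof -
    have "y - a (\<sigma> n) = (x - a n) + (a n + (y - x) - a (\<sigma> n))" by simp
    then have "norm (y - a (\<sigma> n)) \<le> norm (x - a n) + norm (a n + (y - x) - a (\<sigma> n))"
      by (metis norm_triangle_ineq)
    with that \<sigma>(2)[of n] show ?thesis by (simp add: dist_norm)
  qed
  then have "\<sigma> ` {n. a n \<in> ball x S} \<subseteq> {n. a n \<in> ball y (S + L)}" by blast
  moreover have "finite {n. a n \<in> ball y (S + L)}"
    using discrete unfolding discrete_multiset_def by blast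
  moreover have "inj_on \<sigma> {n. a n \<in> ball x S}"
    using \<sigma>(1) by (meson bij_is_inj inj_on_subset subset_UNIV)
  ultimately show ?thesis
    unfolding num_points_def by (metis card_image card_mono)
qed

section \<open>Counting points in balls of different radii\<close>

lemma measure_ball_eq:
  fixes x :: "'a::euclidean_space"
  assumes "0 \<le> r"
  shows "measure lebesgue (ball x r) = unit_ball_vol (real DIM('a)) * r ^ DIM('a)"
  using content_ball[OF assms, of x] by simp

lemma integral_sum_indicator_balls:
  fixes a :: "nat \<Rightarrow> 'a::euclidean_space"
  assumes "0 \<le> T"
  shows "integrable lebesgue (\<lambda>w. \<Sum>n\<in>F. indicator (ball (a n) T) w :: real)"
    and "(\<integral>w. (\<Sum>n\<in>F. indicator (ball (a n) T) w) \<partial>lebesgue)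
           = real (card F) * (unit_ball_vol (real DIM('a)) * T ^ DIM('a))"
proof -
  have int: "integrable lebesgue (indicator (ball c r) :: 'a \<Rightarrow> real)" for c r
    using lmeasurable_ball[of c r] by (simp add: fmeasurable_def integrable_indicator_iff)
  show "integrable lebesgue (\<lambda>w. \<Sum>n\<in>F. indicator (ball (a n) T) w :: real)"
    using int by (intro Bochner_Integration.integrable_sum)
  show "(\<integral>w. (\<Sum>n\<in>F. indicator (ball (a n) T) w) \<partial>lebesgue)
           = real (card F) * (unit_ball_vol (real DIM('a)) * T ^ DIM('a))"
    using int assms by (simp add: Bochner_Integration.integral_sum content_ball)
qed

text \<open>
  The balls of radius \<open>T\<close> around the points in \<open>B(z,R)\<close> lie in \<open>B(z,R+T)\<close> and cover each location
  at most \<open>c\<close> times, because the number of them that cover \<open>w\<close> is at most the number of points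
  in \<open>B(w,T)\<close>.  Compare total volumes; the volume of the unit ball cancels.
\<close>

lemma num_points_ball_upper:
  fixes a :: "nat \<Rightarrow> 'a::euclidean_space"
  assumes discrete: "discrete_multiset a" and "0 \<le> T" "0 \<le> R"
    and upper: "\<And>w. num_points a (ball w T) \<le> c"
  shows "real (num_points a (ball z R)) * T ^ DIM('a) \<le> real c * (R + T) ^ DIM('a)"
proof -
  let ?F = "{n. a n \<in> ball z R}"
  let ?v = "unit_ball_vol (real DIM('a))"
  have fin: "finite {n. a n \<in> ball w r}" for w r
    using discrete unfolding discrete_multiset_def by blast
  have int: "integrable lebesgue (\<lambda>w. real c * indicator (ball z (R + T)) w :: real)"
    using lmeasurable_ball[of z "R + T"] by (simp add: fmeasurable_def integrable_indicator_iff)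
  have pointwise: "(\<Sum>n\<in>?F. indicator (ball (a n) T) w :: real)
      \<le> real c * indicator (ball z (R + T)) w" for w
  proof (cases "w \<in> ball z (R + T)")
    case True
    have "(\<Sum>n\<in>?F. indicator (ball (a n) T) w :: real) = real (card {n \<in> ?F. w \<in> ball (a n) T})"
      using fin by (simp add: indicator_def sum.If_cases Int_def)
    also have "card {n \<in> ?F. w \<in> ball (a n) T} \<le> num_points a (ball w T)"
      unfolding num_points_def by (rule card_mono[OF fin]) (auto simp: dist_commute)
    also have "\<dots> \<le> c" by (rule upper)
    finally show ?thesis using True by simp
  next
    case False
    have "w \<notin> ball (a n) T" if "n \<in> ?F" for n
      using that False dist_triangle[of z w "a n"] by auto
    then show ?thesis using False by (simp add: indicator_def)
  qed
  have "real (card ?F) * (?v * T ^ DIM('a)) = (\<integral>w. (\<Sum>n\<in>?F. indicator (ball (a n) T) w) \<partial>lebesgue)"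
    using integral_sum_indicator_balls(2)[OF \<open>0 \<le> T\<close>, where F = ?F and a = a] by simp
  also have "\<dots> \<le> (\<integral>w. real c * indicator (ball z (R + T)) w \<partial>lebesgue)"
    by (rule integral_mono[OF integral_sum_indicator_balls(1)[OF \<open>0 \<le> T\<close>] int pointwise])
  also have "\<dots> = real c * (?v * (R + T) ^ DIM('a))"
    using assms by (simp add: content_ball)
  finally have "?v * (real (card ?F) * T ^ DIM('a)) \<le> ?v * (real c * (R + T) ^ DIM('a))"
    by (simp add: mult_ac)
  then show ?thesis
    unfolding num_points_def by (simp add: mult_le_cancel_left_pos unit_ball_vol_pos)
qed

text \<open>
  Every point within distance \<open>T\<close> of a location in \<open>B(z,R-T)\<close> lies in \<open>B(z,R)\<close>.  Hence the balls of
  radius \<open>T\<close> around the points in \<open>B(z,R)\<close> cover each such location at least \<open>c\<close> times.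
\<close>

lemma num_points_ball_lower:
  fixes a :: "nat \<Rightarrow> 'a::euclidean_space"
  assumes discrete: "discrete_multiset a" and "0 \<le> T" "T \<le> R"
    and lower: "\<And>w. c \<le> num_points a (ball w T)"
  shows "real c * (R - T) ^ DIM('a) \<le> real (num_points a (ball z R)) * T ^ DIM('a)"
proof -
  let ?F = "{n. a n \<in> ball z R}"
  let ?v = "unit_ball_vol (real DIM('a))"
  have fin: "finite {n. a n \<in> ball w r}" for w r
    using discrete unfolding discrete_multiset_def by blast
  have int: "integrable lebesgue (\<lambda>w. real c * indicator (ball z (R - T)) w :: real)"
    using lmeasurable_ball[of z "R - T"] by (simp add: fmeasurable_def integrable_indicator_iff)
  have pointwise: "real c * indicator (ball z (R - T)) w
      \<le> (\<Sum>n\<in>?F. indicator (ball (a n) T) w :: real)" for w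
  proof (cases "w \<in> ball z (R - T)")
    case True
    have "c \<le> num_points a (ball w T)" by (rule lower)
    also have "\<dots> \<le> card {n \<in> ?F. w \<in> ball (a n) T}"
      unfolding num_points_def
    proof (rule card_mono)
      show "finite {n \<in> ?F. w \<in> ball (a n) T}" using fin by simp
      show "{n. a n \<in> ball w T} \<subseteq> {n \<in> ?F. w \<in> ball (a n) T}"
      proof
        fix n assume "n \<in> {n. a n \<in> ball w T}"
        then show "n \<in> {n \<in> ?F. w \<in> ball (a n) T}"
          using True dist_triangle[of z "a n" w] by (auto simp: dist_commute)
      qed
    qed
    also have "real (card {n \<in> ?F. w \<in> ball (a n) T}) = (\<Sum>n\<in>?F. indicator (ball (a n) T) w)"
      using fin by (simp add: indicator_def sum.If_cases Int_def)
    finally show ?thesis using True by simp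
  next
    case False
    then show ?thesis by (simp add: sum_nonneg)
  qed
  have "real c * (?v * (R - T) ^ DIM('a)) = (\<integral>w. real c * indicator (ball z (R - T)) w \<partial>lebesgue)"
    using assms by (simp add: content_ball)
  also have "\<dots> \<le> (\<integral>w. (\<Sum>n\<in>?F. indicator (ball (a n) T) w) \<partial>lebesgue)"
    by (rule integral_mono[OF int integral_sum_indicator_balls(1)[OF \<open>0 \<le> T\<close>] pointwise])
  also have "\<dots> = real (card ?F) * (?v * T ^ DIM('a))"
    using integral_sum_indicator_balls(2)[OF \<open>0 \<le> T\<close>, where F = ?F and a = a] by simp
  finally have "?v * (real c * (R - T) ^ DIM('a)) \<le> ?v * (real (card ?F) * T ^ DIM('a))"
    by (simp add: mult_ac)
  then show ?thesis
    unfolding num_points_def by (simp add: mult_le_cancel_left_pos unit_ball_vol_pos)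
qed

section \<open>Existence of the density\<close>

lemma tendsto_shifted_power_ratio:
  fixes k :: real
  shows "((\<lambda>R. ((R + k) / R) ^ d) \<longlongrightarrow> 1) at_top"
proof -
  have "((\<lambda>R. 1 + k / R) \<longlongrightarrow> 1 + 0) at_top"
    by (intro tendsto_intros tendsto_divide_0[OF tendsto_const]
        filterlim_mono[OF filterlim_ident]) (auto simp: at_top_le_at_infinity)
  moreover have "\<forall>\<^sub>F R in at_top. 1 + k / R = (R + k) / R"
    using eventually_gt_at_top[of 0] by eventually_elim (simp add: field_simps)
  ultimately have "((\<lambda>R. (R + k) / R) \<longlongrightarrow> 1) at_top"
    by (simp add: tendsto_cong)
  from tendsto_power[OF this, of d] show ?thesis by simp
qed

text \<open>
  Both sides are compared with the number of points in one ball of radius \<open>R\<close>.  The boundary layers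
  lost in the two counts have bounded thickness, so they disappear in the limit \<open>R \<rightarrow> \<infinity>\<close>.
\<close>

lemma density_comparison:
  fixes a :: "nat \<Rightarrow> 'a::euclidean_space"
  assumes discrete: "discrete_multiset a"
    and shift: "\<And>x y S. num_points a (ball x S) \<le> num_points a (ball y (S + L))"
    and "0 \<le> L" "0 \<le> S" "L \<le> T"
  shows "real (num_points a (ball x S)) * (T - L) ^ DIM('a)
           \<le> real (num_points a (ball y T)) * (S + L) ^ DIM('a)"
proof -
  let ?d = "DIM('a)"
  let ?p = "real (num_points a (ball x S))" and ?q = "real (num_points a (ball y T))"
  \<comment> \<open>By \<open>shift\<close>, the number of points in \<open>ball x S\<close> bounds that in every ball of radius \<open>S + L\<close>
     from below, and the number in \<open>ball y T\<close> that in every ball of radius \<open>T - L\<close> from above.\<close>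
  have below: "?p * (R - (S + L)) ^ ?d \<le> real (num_points a (ball 0 R)) * (S + L) ^ ?d"
    if "R \<ge> S + L" for R
    using assms that by (intro num_points_ball_lower) auto
  have above: "real (num_points a (ball 0 R)) * (T - L) ^ ?d \<le> ?q * (R + (T - L)) ^ ?d"
    if "R \<ge> 0" for R
    using assms that shift[of _ "T - L" y] by (intro num_points_ball_upper) auto
  have "\<forall>\<^sub>F R in at_top. ?p * (T - L) ^ ?d * ((R + - (S + L)) / R) ^ ?d
          \<le> ?q * (S + L) ^ ?d * ((R + (T - L)) / R) ^ ?d"
    using eventually_ge_at_top[of "S + L"] eventually_gt_at_top[of 0]
  proof eventually_elim
    case (elim R)
    have "?p * (R - (S + L)) ^ ?d * (T - L) ^ ?d
        \<le> real (num_points a (ball 0 R)) * (S + L) ^ ?d * (T - L) ^ ?d"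
      using below[OF elim(1)] assms by (intro mult_right_mono) auto
    also have "\<dots> = real (num_points a (ball 0 R)) * (T - L) ^ ?d * (S + L) ^ ?d"
      by simp
    also have "\<dots> \<le> ?q * (R + (T - L)) ^ ?d * (S + L) ^ ?d"
      using above elim assms by (intro mult_right_mono) auto
    finally have "?p * (R - (S + L)) ^ ?d * (T - L) ^ ?d / R ^ ?d
        \<le> ?q * (R + (T - L)) ^ ?d * (S + L) ^ ?d / R ^ ?d"
      using elim by (intro divide_right_mono) auto
    then show ?case by (simp add: power_divide mult_ac del: minus_add_distrib)
  qed
  moreover have "((\<lambda>R. ?p * (T - L) ^ ?d * ((R + - (S + L)) / R) ^ ?d)
      \<longlongrightarrow> ?p * (T - L) ^ ?d * 1) at_top"
    by (intro tendsto_mult tendsto_const tendsto_shifted_power_ratio)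
  moreover have "((\<lambda>R. ?q * (S + L) ^ ?d * ((R + (T - L)) / R) ^ ?d)
      \<longlongrightarrow> ?q * (S + L) ^ ?d * 1) at_top"
    by (intro tendsto_mult tendsto_const tendsto_shifted_power_ratio)
  ultimately have "?p * (T - L) ^ ?d * 1 \<le> ?q * (S + L) ^ ?d * 1"
    using tendsto_le trivial_limit_at_top_linorder by blast
  then show ?thesis by simp
qed

text \<open>
  Here \<open>D\<close> counts points per \<open>r\<^sup>d\<close>, where \<open>d\<close> is the dimension, instead of points per volume of a
  ball of radius \<open>r\<close>; the density itself is \<open>D\<close> divided by the volume of the unit ball.
\<close>

lemma separating_density:
  fixes a :: "nat \<Rightarrow> 'a::euclidean_space"
  assumes discrete: "discrete_multiset a"
    and shift: "\<And>x y S. num_points a (ball x S) \<le> num_points a (ball y (S + L))"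
    and "0 < L"
  obtains D where "D > 0"
    and "\<And>x T. 0 < T \<Longrightarrow> real (num_points a (ball x T)) \<le> D * (T + L) ^ DIM('a)"
    and "\<And>x T. L < T \<Longrightarrow> D * (T - L) ^ DIM('a) \<le> real (num_points a (ball x T))"
proof -
  let ?d = "DIM('a)"
  let ?f = "\<lambda>(x, S). real (num_points a (ball x S)) / (S + L) ^ ?d"
  let ?I = "UNIV \<times> {0<..} :: ('a \<times> real) set"
  define D where "D = (SUP i\<in>?I. ?f i)"
  have le: "?f (x, S) \<le> real (num_points a (ball y T)) / (T - L) ^ ?d"
    if "0 < S" "L < T" for x y S T
    using density_comparison[OF discrete shift, of S T x y] that \<open>0 < L\<close>
    by (simp add: divide_simps mult_ac)
  have bdd: "bdd_above (?f ` ?I)"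
    by (rule bdd_aboveI2[where M = "real (num_points a (ball 0 (L + 1))) / (L + 1 - L) ^ ?d"])
      (use le[where T = "L + 1" and y = 0] in auto)
  have upper: "?f (x, S) \<le> D" if "0 < S" for x S
    unfolding D_def using that bdd by (intro cSUP_upper) auto
  have lower: "D \<le> real (num_points a (ball y T)) / (T - L) ^ ?d" if "L < T" for y T
    unfolding D_def using that le by (intro cSUP_least) auto
  show thesis
  proof (rule that)
    \<comment> \<open>The ball of radius 1 around the first point is not empty, so one of the ratios is positive.\<close>
    have "finite {n. a n \<in> ball (a 0) 1}"
      using discrete unfolding discrete_multiset_def by blast
    moreover have "0 \<in> {n. a n \<in> ball (a 0) 1}" by simp
    ultimately have "0 < num_points a (ball (a 0) 1)"
      unfolding num_points_def card_gt_0_iff by blast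
    then have "0 < ?f (a 0, 1)" using \<open>0 < L\<close> by simp
    also have "\<dots> \<le> D" by (rule upper) simp
    finally show "D > 0" .
    show "real (num_points a (ball x T)) \<le> D * (T + L) ^ ?d" if "0 < T" for x T
      using upper[OF that, of x] that \<open>0 < L\<close> by (simp add: divide_simps)
    show "D * (T - L) ^ ?d \<le> real (num_points a (ball x T))" if "L < T" for x T
      using lower[OF that, of x] that by (simp add: divide_simps)
  qed
qed

theorem theorem4:
  fixes a :: "nat \<Rightarrow> real ^ 'd"
  assumes "roughly_shift_invariant a"
  shows "\<exists>D::real. D > 0 \<and>
    uniform_limit UNIV
      (\<lambda>T x. real (num_points a (ball x T)) / measure lebesgue (ball x T))
      (\<lambda>x. D) at_top"
proof -
  let ?d = "DIM(real ^ 'd)"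
  let ?v = "unit_ball_vol (real ?d)"
  have discrete: "discrete_multiset a"
    using assms unfolding roughly_shift_invariant_def by blast
  obtain L where L: "L > 0" "\<And>x. \<exists>\<sigma>. bij \<sigma> \<and> (\<forall>n. norm (a n + x - a (\<sigma> n)) < L)"
    using assms by (rule roughly_shift_invariantE) blast
  obtain D where D: "D > 0"
    and upper: "\<And>x T. 0 < T \<Longrightarrow> real (num_points a (ball x T)) \<le> D * (T + L) ^ ?d"
    and lower: "\<And>x T. L < T \<Longrightarrow> D * (T - L) ^ ?d \<le> real (num_points a (ball x T))"
    using separating_density[OF discrete num_points_ball_shift[OF discrete L(2)] L(1)] by blast
  have v: "?v > 0" by (simp add: unit_ball_vol_pos)
  have tendsto: "((\<lambda>T. D / ?v * ((T + k) / T) ^ ?d) \<longlongrightarrow> D / ?v) at_top" for k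
    using tendsto_mult[OF tendsto_const tendsto_shifted_power_ratio, of "D / ?v" k ?d] by simp
  have "uniform_limit UNIV
      (\<lambda>T x. real (num_points a (ball x T)) / measure lebesgue (ball x T))
      (\<lambda>x. D / ?v) at_top"
  proof (rule uniform_limitI)
    fix e :: real assume "e > 0"
    show "\<forall>\<^sub>F T in at_top. \<forall>x\<in>UNIV.
        dist (real (num_points a (ball x T)) / measure lebesgue (ball x T)) (D / ?v) < e"
      using tendstoD[OF tendsto[of L] \<open>e > 0\<close>] tendstoD[OF tendsto[of "- L"] \<open>e > 0\<close>]
        eventually_gt_at_top[of L]
    proof eventually_elim
      case (elim T)
      have T: "T > 0" using elim(3) L(1) by simp
      have "dist (real (num_points a (ball x T)) / measure lebesgue (ball x T)) (D / ?v) < e" for x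
      proof -
        have meas: "measure lebesgue (ball x T) = ?v * T ^ ?d"
          using T by (intro measure_ball_eq) simp
        let ?r = "real (num_points a (ball x T)) / (?v * T ^ ?d)"
        have "?r \<le> D * (T + L) ^ ?d / (?v * T ^ ?d)"
          using upper[OF T] T v by (intro divide_right_mono) auto
        also have "\<dots> = D / ?v * ((T + L) / T) ^ ?d"
          by (simp add: power_divide)
        finally have r_upper: "?r \<le> D / ?v * ((T + L) / T) ^ ?d" .
        have "D / ?v * ((T + - L) / T) ^ ?d = D * (T - L) ^ ?d / (?v * T ^ ?d)"
          by (simp add: power_divide)
        also have "\<dots> \<le> ?r"
          using lower[OF elim(3)] T v by (intro divide_right_mono) auto
        finally show ?thesis
          using r_upper elim(1,2) unfolding meas dist_real_def by linarith
      qed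
      then show ?case by blast
    qed
  qed
  moreover have "D / ?v > 0" using D v by simp
  ultimately show ?thesis by blast
qed

end
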